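(* Let $X$ be a finite ordered set. The set $S(X)$ of irreducible words over $X$ together with the empty word $\emptyset$, equipped with the multiplication described in the context, is a free Steiner loop with free generators $X$ (and identity element $\emptyset$).
   Context: A loop is a set $L$ with a binary operation for which all equations $a\cdot y=b$ and $x\cdot a=b$ are uniquely solvable and which has a two-sided identity $e$. A Steiner loop is a commutative loop with $x\cdot x=e$ and $x\cdot(x\cdot y)=y$ for all $x,y$ (equivalently, a diassociative loop of exponent $2$). Steiner loops form a variety; "free Steiner loop with free generators $X$" is meant in this variety. Construction. Let $X$ be a finite (totally) ordered set and $W(X)$ the set of nonempty non-associative words in $X$; $|w|$ denotes the length of $w$. Order $W(X)$ as follows: on words of length $1$ use the order of $X$; $v>w$ if $|v|>|w|$, or if $|v|=|w|>1$, $v=v_1v_2$, $w=w_1w_2$ and either $v_1>w_1$, or $v_1=w_1$ and $v_2>w_2$. Define the set $S(X)^{*}\subset W(X)$ of irreducible words by induction on length: $X\subset S(X)^{*}$; and a word $wv$ belongs to $S(X)^{*}$ precisely if $v,w\in S(X)^{*}$, $v<w$, and, in case $w=w_1w_2$ is a word of length greater than $1$, $v\neq w_1$ and $v\neq w_2$. Put $S(X)=S(X)^{*}\cup\{\emptyset\}$. The multiplication on $S(X)$ is: (0) $\emptyset\cdot v=v\cdot\emptyset=v$; (1) $v\cdot w=w\cdot v=vw$ if $vw\in S(X)^{*}$; (2) if $vw\in S(X)^{*}$ then $(vw)\cdot w=w\cdot(vw)=v$, and if $wv\in S(X)^{*}$ then $(wv)\cdot w=w\cdot(wv)=v$; (3)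 $v\cdot v=\emptyset$. *)

theory Defs
  imports "HOL-Algebra.Group"
begin

section \<open>Steiner loops\<close>

text \<open>
  The record \<open>'a monoid\<close> only supplies carrier, multiplication and unit;
  associativity is not assumed anywhere.
\<close>

locale loop =
  fixes L (structure)
  assumes m_closed: "\<lbrakk>x \<in> carrier L; y \<in> carrier L\<rbrakk> \<Longrightarrow> x \<otimes> y \<in> carrier L"
    and one_closed: "\<one> \<in> carrier L"
    and l_one: "x \<in> carrier L \<Longrightarrow> \<one> \<otimes> x = x"
    and r_one: "x \<in> carrier L \<Longrightarrow> x \<otimes> \<one> = x"
    and l_div: "\<lbrakk>a \<in> carrier L; b \<in> carrier L\<rbrakk> \<Longrightarrow> \<exists>!y. y \<in> carrier L \<and> a \<otimes> y = b"
    and r_div: "\<lbrakk>a \<in> carrier L; b \<in> carrier L\<rbrakk> \<Longrightarrow> \<exists>!x. x \<in> carrier L \<and> x \<otimes> a = b"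

locale steiner_loop = loop +
  assumes m_comm: "\<lbrakk>x \<in> carrier L; y \<in> carrier L\<rbrakk> \<Longrightarrow> x \<otimes> y = y \<otimes> x"
    and m_self: "x \<in> carrier L \<Longrightarrow> x \<otimes> x = \<one>"
    and m_cancel: "\<lbrakk>x \<in> carrier L; y \<in> carrier L\<rbrakk> \<Longrightarrow> x \<otimes> (x \<otimes> y) = y"

text \<open>
  Universal property in the variety of Steiner loops.  A definition cannot quantify
  over types, so the type of the elements of the test loops is a parameter; freeness
  means that the property holds for every type \<open>'b\<close>.  Multiplicative maps between
  loops preserve the unit, so \<^const>\<open>hom\<close> is the right notion of homomorphism;
  extensionality makes uniqueness refer to values on the carrier only.
\<close>

definition free_steiner_loop :: "'b itself \<Rightarrow> 'c monoid \<Rightarrow> 'c set \<Rightarrow> bool" where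
  "free_steiner_loop (_ :: 'b itself) F B \<longleftrightarrow>
     steiner_loop F \<and> B \<subseteq> carrier F \<and>
     (\<forall>L :: 'b monoid. steiner_loop L \<longrightarrow>
        (\<forall>f \<in> B \<rightarrow> carrier L.
           \<exists>!h. h \<in> hom F L \<inter> extensional (carrier F) \<and> (\<forall>b\<in>B. h b = f b)))"


section \<open>Irreducible words\<close>

datatype 'a word = Gen 'a | Mul "'a word" "'a word"

primrec len :: "'a word \<Rightarrow> nat" where
  "len (Gen x) = 1"
| "len (Mul v w) = len v + len w"

fun word_less :: "'a::linorder word \<Rightarrow> 'a word \<Rightarrow> bool" where
  "word_less v w \<longleftrightarrow>
     len v < len w \<or>
     len v = len w \<and>
       (case (v, w) of
          (Gen x, Gen y) \<Rightarrow> x < y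
        | (Mul v1 v2, Mul w1 w2) \<Rightarrow> word_less v1 w1 \<or> v1 = w1 \<and> word_less v2 w2
        | _ \<Rightarrow> False)"

declare word_less.simps [simp del]

inductive_set irreducible :: "'a::linorder set \<Rightarrow> 'a word set" for X where
  gen: "x \<in> X \<Longrightarrow> Gen x \<in> irreducible X"
| mul: "\<lbrakk>w \<in> irreducible X; v \<in> irreducible X; word_less v w;
         \<And>w1 w2. w = Mul w1 w2 \<Longrightarrow> v \<noteq> w1 \<and> v \<noteq> w2\<rbrakk> \<Longrightarrow> Mul w v \<in> irreducible X"


section \<open>The multiplication on irreducible words\<close>

text \<open>\<^const>\<open>None\<close> plays the role of the empty word.\<close>

definition S_carrier :: "'a::linorder set \<Rightarrow> 'a word option set" where
  "S_carrier X = insert None (Some ` irreducible X)"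

text \<open>
  \<open>S_prod X u v z\<close> says that one of the rules prescribes the value \<open>z\<close> for \<open>u \<cdot> v\<close>.
  That the rules prescribe exactly one value for each pair is not built in.
\<close>

inductive S_prod ::
    "'a::linorder set \<Rightarrow> 'a word option \<Rightarrow> 'a word option \<Rightarrow> 'a word option \<Rightarrow> bool"
  for X where
  unit_l: "v \<in> S_carrier X \<Longrightarrow> S_prod X None v v"
| unit_r: "v \<in> S_carrier X \<Longrightarrow> S_prod X v None v"
| irr: "Mul v w \<in> irreducible X \<Longrightarrow> S_prod X (Some v) (Some w) (Some (Mul v w))"
| irr': "Mul v w \<in> irreducible X \<Longrightarrow> S_prod X (Some w) (Some v) (Some (Mul v w))"
| red_r: "Mul v w \<in> irreducible X \<Longrightarrow> S_prod X (Some (Mul v w)) (Some w) (Some v)"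
| red_r': "Mul v w \<in> irreducible X \<Longrightarrow> S_prod X (Some w) (Some (Mul v w)) (Some v)"
| red_l: "Mul w v \<in> irreducible X \<Longrightarrow> S_prod X (Some (Mul w v)) (Some w) (Some v)"
| red_l': "Mul w v \<in> irreducible X \<Longrightarrow> S_prod X (Some w) (Some (Mul w v)) (Some v)"
| square: "v \<in> S_carrier X \<Longrightarrow> S_prod X v v None"

definition S_loop :: "'a::linorder set \<Rightarrow> 'a word option monoid" where
  "S_loop X = \<lparr>carrier = S_carrier X, mult = (\<lambda>u v. THE z. S_prod X u v z), one = None\<rparr>"

end

theory Submission
  imports Defs
begin

text \<open>
  The rules for \<open>u \<cdot> v = z\<close> define a relation that is invariant under all permutations of
  \<open>(u, v, z)\<close>; since irreducible words are comparable, the relation is a total function of \<open>u\<close>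
  and \<open>v\<close>, and these two facts are exactly the Steiner loop axioms.  A map on the generators
  extends to irreducible words by evaluating them, and every instance of a rule is respected
  because the target satisfies the same laws.
\<close>

section \<open>Length and order of words\<close>

lemma len_pos [simp]: "0 < len w"
  by (induction w) auto

lemma len_neq_0 [simp]: "len w \<noteq> 0"
  by (rule gr_implies_not0, rule len_pos)

lemma word_neq_Mul [simp]: "w \<noteq> Mul v w" "w \<noteq> Mul w v"
  by (rule size_neq_size_imp_neq, simp)+

lemma word_less_imp_len_le: "word_less v w \<Longrightarrow> len v \<le> len w"
  by (subst (asm) word_less.simps) auto

lemma word_less_Gen_Gen [simp]: "word_less (Gen x) (Gen y) \<longleftrightarrow> x < y"
  by (subst word_less.simps) simp

lemma word_less_Gen_Mul [simp]: "word_less (Gen x) (Mul w1 w2)"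
proof -
  have "0 < len w1" "0 < len w2" by simp_all
  then have "len (Gen x) < len (Mul w1 w2)" unfolding len.simps by linarith
  then show ?thesis by (subst word_less.simps) blast
qed

lemma word_less_Mul_Gen [simp]: "\<not> word_less (Mul v1 v2) (Gen y)"
proof
  assume "word_less (Mul v1 v2) (Gen y)"
  then have "len v1 + len v2 \<le> 1" using word_less_imp_len_le by fastforce
  moreover have "0 < len v1" "0 < len v2" by simp_all
  ultimately show False by linarith
qed

lemma word_less_Mul_Mul:
  "word_less (Mul v1 v2) (Mul w1 w2) \<longleftrightarrow>
     len v1 + len v2 < len w1 + len w2 \<or>
     len v1 + len v2 = len w1 + len w2 \<and>
       (word_less v1 w1 \<or> v1 = w1 \<and> word_less v2 w2)"
  by (subst word_less.simps) simp

text \<open>A proper factor is strictly shorter. This rules out the reduction rules in which the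
  smaller argument would have to contain the larger one.\<close>

lemma not_word_less_Mul [simp]: "\<not> word_less (Mul v w) v" "\<not> word_less (Mul v w) w"
  by (auto dest: word_less_imp_len_le)

lemma word_less_irrefl [simp]: "\<not> word_less w w"
  by (induction w) (auto simp: word_less_Mul_Mul)

lemma word_less_asym: "word_less v w \<Longrightarrow> \<not> word_less w v"
proof (induction v arbitrary: w)
  case (Gen x)
  then show ?case by (cases w) auto
next
  case (Mul v1 v2)
  then show ?case by (cases w) (auto simp: word_less_Mul_Mul)
qed

text \<open>At equal lengths the comparison passes to the left factors and, if these agree, to the
  right ones, so induction on \<open>v\<close> with \<open>w\<close> arbitrary suffices.\<close>

lemma word_less_linear: "word_less v w \<or> v = w \<or> word_less w v"
proof (induction v arbitrary: w)
  case (Gen x)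
  then show ?case by (cases w) auto
next
  case (Mul v1 v2)
  show ?case
  proof (cases w)
    case (Gen y)
    then show ?thesis by simp
  next
    case w: (Mul w1 w2)
    show ?thesis
      using Mul.IH(1)[of w1] Mul.IH(2)[of w2] by (auto simp: w word_less_Mul_Mul)
  qed
qed

section \<open>Symmetries of the product relation\<close>

lemma irreducible_Mul_iff:
  "Mul w v \<in> irreducible X \<longleftrightarrow>
     w \<in> irreducible X \<and> v \<in> irreducible X \<and> word_less v w \<and>
     (\<forall>w1 w2. w = Mul w1 w2 \<longrightarrow> v \<noteq> w1 \<and> v \<noteq> w2)"
  by (subst irreducible.simps) auto

lemma S_prod_in_carrier:
  assumes "S_prod X u v z"
  shows "u \<in> S_carrier X" "v \<in> S_carrier X" "z \<in> S_carrier X"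
  using assms by (cases; auto simp: S_carrier_def irreducible_Mul_iff)+

lemma S_prod_commute: "S_prod X u v z \<Longrightarrow> S_prod X v u z"
  by (erule S_prod.cases) (auto intro: S_prod.intros)

text \<open>Exchanging the second argument with the value swaps \<open>irr\<close> with
  \<open>red_l'\<close>, \<open>irr'\<close> with \<open>red_r'\<close>, \<open>red_r\<close> with
  \<open>red_l\<close> and \<open>unit_r\<close> with \<open>square\<close>, and fixes
  \<open>unit_l\<close>. It is the relational form of \<open>u (u v) = v\<close>.\<close>

lemma S_prod_rotate: "S_prod X u v z \<Longrightarrow> S_prod X u z v"
  by (erule S_prod.cases) (auto intro: S_prod.intros)

section \<open>Existence and uniqueness of products\<close>

lemma S_prod_ex_of_less:
  assumes "v \<in> irreducible X" "w \<in> irreducible X" "word_less v w"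
  shows "\<exists>z. S_prod X (Some w) (Some v) z"
proof (cases "Mul w v \<in> irreducible X")
  case True
  then show ?thesis by (blast intro: S_prod.irr)
next
  case False
  \<comment> \<open>As \<open>v\<close> is smaller than \<open>w\<close>, the word
    \<open>Mul w v\<close> can only be reducible because \<open>v\<close> is a factor of
    \<open>w\<close>; a reduction rule then gives the cofactor as product.\<close>
  with assms obtain w1 w2 where "w = Mul w1 w2" "v = w1 \<or> v = w2"
    by (auto simp: irreducible_Mul_iff)
  with assms(2) show ?thesis by (blast intro: S_prod.red_l S_prod.red_r)
qed

lemma S_prod_ex:
  assumes "u \<in> S_carrier X" "v \<in> S_carrier X"
  shows "\<exists>z. S_prod X u v z"
proof (cases "u = None \<or> v = None")
  case True
  with assms show ?thesis by (blast intro: S_prod.unit_l S_prod.unit_r)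
next
  case False
  with assms obtain a b where ab: "u = Some a" "v = Some b" "a \<in> irreducible X" "b \<in> irreducible X"
    by (auto simp: S_carrier_def)
  consider "word_less a b" | "a = b" | "word_less b a"
    using word_less_linear by blast
  then show ?thesis
  proof cases
    case 1
    with ab S_prod_ex_of_less show ?thesis by (blast intro: S_prod_commute)
  next
    case 2
    with ab assms(1) show ?thesis by (blast intro: S_prod.square)
  next
    case 3
    with ab S_prod_ex_of_less show ?thesis by blast
  qed
qed

lemma S_prod_None_left: "S_prod X None v z \<Longrightarrow> z = v"
  by (erule S_prod.cases) auto

lemma S_prod_self: "S_prod X v v z \<Longrightarrow> z = None"
  by (erule S_prod.cases) (auto simp: irreducible_Mul_iff dest: sym)

text \<open>With the larger word first, only \<open>irr\<close>, \<open>red_r\<close> and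
  \<open>red_l\<close> can apply; asymmetry and length exclude the rest. A word multiplied by one of
  its own factors is reducible, which separates \<open>irr\<close> from the other two.\<close>

lemma S_prod_lessD:
  assumes "S_prod X (Some a) (Some b) z" "word_less b a"
  shows "if Mul a b \<in> irreducible X then z = Some (Mul a b)
         else \<exists>c. z = Some c \<and> (a = Mul b c \<or> a = Mul c b)"
  using assms
  by (cases rule: S_prod.cases) (auto simp: irreducible_Mul_iff dest: word_less_asym)

text \<open>The cofactor is unambiguous: if \<open>b\<close> is both the left and the right factor
  of \<open>a\<close>, then \<open>a = Mul b b\<close> and either reading gives
  \<open>b\<close>.\<close>

lemma S_prod_unique_less:
  assumes "S_prod X (Some a) (Some b) z" "S_prod X (Some a) (Some b) z'" "word_less b a"
  shows "z = z'"
  using S_prod_lessD[OF assms(1,3)] S_prod_lessD[OF assms(2,3)] by (auto split: if_splits)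

lemma S_prod_unique:
  assumes "S_prod X u v z" "S_prod X u v z'"
  shows "z = z'"
proof (cases "u = None \<or> v = None")
  case True
  with assms show ?thesis by (metis S_prod_None_left S_prod_commute)
next
  case False
  then obtain a b where ab: "u = Some a" "v = Some b" by auto
  consider "word_less a b" | "a = b" | "word_less b a"
    using word_less_linear by blast
  then show ?thesis
  proof cases
    case 1
    with assms ab show ?thesis by (blast intro: S_prod_unique_less S_prod_commute)
  next
    case 2
    with assms ab show ?thesis by (metis S_prod_self)
  next
    case 3
    with assms ab show ?thesis by (blast intro: S_prod_unique_less)
  qed
qed

lemma S_prod_ex1:
  "\<lbrakk>u \<in> S_carrier X; v \<in> S_carrier X\<rbrakk> \<Longrightarrow> \<exists>!z. S_prod X u v z"
  using S_prod_ex S_prod_unique by metis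

section \<open>Irreducible words form a Steiner loop\<close>

lemma S_loop_simps [simp]:
  "carrier (S_loop X) = S_carrier X" "\<one>\<^bsub>S_loop X\<^esub> = None"
  by (simp_all add: S_loop_def)

lemma S_loop_mult_eqI: "S_prod X u v z \<Longrightarrow> u \<otimes>\<^bsub>S_loop X\<^esub> v = z"
  unfolding S_loop_def by (auto intro: the_equality S_prod_unique)

lemma S_prod_mult:
  "\<lbrakk>u \<in> S_carrier X; v \<in> S_carrier X\<rbrakk> \<Longrightarrow> S_prod X u v (u \<otimes>\<^bsub>S_loop X\<^esub> v)"
  using S_prod_ex S_loop_mult_eqI by metis

lemma steiner_loop_S_loop: "steiner_loop (S_loop X)"
proof -
  let ?L = "S_loop X"
  have None: "None \<in> S_carrier X" by (simp add: S_carrier_def)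
  have closed: "u \<otimes>\<^bsub>?L\<^esub> v \<in> S_carrier X" if "u \<in> S_carrier X" "v \<in> S_carrier X" for u v
    using S_prod_mult[OF that] by (rule S_prod_in_carrier)
  have comm: "u \<otimes>\<^bsub>?L\<^esub> v = v \<otimes>\<^bsub>?L\<^esub> u" if "u \<in> S_carrier X" "v \<in> S_carrier X" for u v
    using that by (blast intro: S_loop_mult_eqI S_prod_commute S_prod_mult)
  have cancel: "u \<otimes>\<^bsub>?L\<^esub> (u \<otimes>\<^bsub>?L\<^esub> v) = v" if "u \<in> S_carrier X" "v \<in> S_carrier X" for u v
    using that by (blast intro: S_loop_mult_eqI S_prod_rotate S_prod_mult)
  \<comment> \<open>The solution of \<open>a y = b\<close> is \<open>y = a b\<close>; multiplying
    the equation by \<open>a\<close> shows that there is no other.\<close>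
  have div: "\<exists>!y. y \<in> S_carrier X \<and> a \<otimes>\<^bsub>?L\<^esub> y = b"
    if "a \<in> S_carrier X" "b \<in> S_carrier X" for a b
    using that closed cancel by metis
  show ?thesis
  proof (unfold_locales, unfold S_loop_simps)
    fix a b assume ab: "a \<in> S_carrier X" "b \<in> S_carrier X"
    show "\<exists>!x. x \<in> S_carrier X \<and> x \<otimes>\<^bsub>?L\<^esub> a = b"
      using div[OF ab] comm[OF ab(1)] by metis
    show "\<exists>!y. y \<in> S_carrier X \<and> a \<otimes>\<^bsub>?L\<^esub> y = b"
      using ab by (rule div)
  qed (auto intro: None closed comm cancel S_loop_mult_eqI S_prod.intros)
qed

section \<open>Evaluation of words in a Steiner loop\<close>

primrec word_eval :: "('b, 'm) monoid_scheme \<Rightarrow> ('a \<Rightarrow> 'b) \<Rightarrow> 'a word \<Rightarrow> 'b" where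
  "word_eval L g (Gen x) = g x"
| "word_eval L g (Mul v w) = word_eval L g v \<otimes>\<^bsub>L\<^esub> word_eval L g w"

definition S_eval :: "('b, 'm) monoid_scheme \<Rightarrow> ('a \<Rightarrow> 'b) \<Rightarrow> 'a word option \<Rightarrow> 'b" where
  "S_eval L g u = (case u of None \<Rightarrow> \<one>\<^bsub>L\<^esub> | Some w \<Rightarrow> word_eval L g w)"

lemma S_eval_simps [simp]:
  "S_eval L g None = \<one>\<^bsub>L\<^esub>" "S_eval L g (Some w) = word_eval L g w"
  by (simp_all add: S_eval_def)

context steiner_loop
begin

lemma m_cancel_right:
  assumes "x \<in> carrier L" "y \<in> carrier L"
  shows "(x \<otimes> y) \<otimes> y = x" "y \<otimes> (x \<otimes> y) = x" "(x \<otimes> y) \<otimes> x = y"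
  using assms m_cancel m_comm m_closed by metis+

lemma word_eval_closed:
  "\<lbrakk>w \<in> irreducible X; g \<in> X \<rightarrow> carrier L\<rbrakk> \<Longrightarrow> word_eval L g w \<in> carrier L"
  by (induction rule: irreducible.induct) (auto intro: m_closed)

lemma S_eval_closed:
  "\<lbrakk>u \<in> S_carrier X; g \<in> X \<rightarrow> carrier L\<rbrakk> \<Longrightarrow> S_eval L g u \<in> carrier L"
  by (auto simp: S_carrier_def one_closed word_eval_closed)

text \<open>Each rule turns into an identity of \<open>L\<close>: the primed rules use
  commutativity, the reductions cancellation, and \<open>square\<close> uses exponent 2. Working
  with the relation allows a case analysis on the rules.\<close>

lemma S_eval_mult:
  assumes "S_prod X u v z" and g: "g \<in> X \<rightarrow> carrier L"
  shows "S_eval L g z = S_eval L g u \<otimes> S_eval L g v"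
proof -
  have *: "word_eval L g v \<in> carrier L \<and> word_eval L g w \<in> carrier L"
    if "Mul v w \<in> irreducible X" for v w
    using that word_eval_closed[OF _ g] by (auto simp: irreducible_Mul_iff)
  note closed = S_eval_closed[OF _ g]
  show ?thesis
    using assms(1)
    by cases
      (auto dest!: * closed intro: m_comm simp: l_one r_one m_self m_cancel m_cancel_right)
qed

text \<open>The image of the empty word is idempotent, while every square in \<open>L\<close> is the
  unit.\<close>

lemma hom_S_loop_one:
  assumes "h \<in> hom (S_loop X) L"
  shows "h None = \<one>"
proof -
  interpret S: steiner_loop "S_loop X" by (rule steiner_loop_S_loop)
  have "None \<in> carrier (S_loop X)" "None \<otimes>\<^bsub>S_loop X\<^esub> None = None"
    using S.one_closed S.l_one[OF S.one_closed] by simp_all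
  then have "h None \<in> carrier L" "h None = h None \<otimes> h None"
    using assms hom_in_carrier[OF assms] hom_mult[OF assms, of None None] by auto
  then show ?thesis using m_self by simp
qed

lemma hom_S_loop_eq_S_eval:
  assumes h: "h \<in> hom (S_loop X) L" and g: "\<And>x. x \<in> X \<Longrightarrow> h (Some (Gen x)) = g x"
    and u: "u \<in> S_carrier X"
  shows "h u = S_eval L g u"
proof -
  have "h (Some w) = word_eval L g w" if "w \<in> irreducible X" for w
    using that
  proof induction
    case (gen x)
    then show ?case by (simp add: g)
  next
    case (mul w v)
    \<comment> \<open>An irreducible compound word is itself the loop product of its two factors.
      Hence the letters generate, and \<open>h\<close> is determined by its values on them.\<close>
    from mul.hyps have "Mul w v \<in> irreducible X" by (rule irreducible.mul)
    then have "Some w \<otimes>\<^bsub>S_loop X\<^esub> Some v = Some (Mul w v)"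
      by (intro S_loop_mult_eqI S_prod.irr)
    with hom_mult[OF h, of "Some w" "Some v"] mul show ?case
      by (simp add: S_carrier_def)
  qed
  with u hom_S_loop_one[OF h] show ?thesis by (auto simp: S_carrier_def)
qed

lemma S_eval_hom:
  assumes g: "g \<in> X \<rightarrow> carrier L"
  shows "restrict (S_eval L g) (S_carrier X) \<in> hom (S_loop X) L"
proof (rule homI)
  fix u v assume "u \<in> carrier (S_loop X)" "v \<in> carrier (S_loop X)"
  then have uv: "u \<in> S_carrier X" "v \<in> S_carrier X" by simp_all
  have "S_prod X u v (u \<otimes>\<^bsub>S_loop X\<^esub> v)" using uv by (rule S_prod_mult)
  from S_eval_mult[OF this g] S_prod_in_carrier(3)[OF this] uv
  show "restrict (S_eval L g) (S_carrier X) (u \<otimes>\<^bsub>S_loop X\<^esub> v) =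
      restrict (S_eval L g) (S_carrier X) u \<otimes> restrict (S_eval L g) (S_carrier X) v"
    by simp
qed (simp add: S_eval_closed[OF _ g])

end

section \<open>The universal property\<close>

lemma free_steiner_loop_S_loop:
  "free_steiner_loop TYPE('b) (S_loop X) ((\<lambda>x. Some (Gen x)) ` X)"
  unfolding free_steiner_loop_def
proof (intro conjI allI impI ballI)
  let ?B = "(\<lambda>x. Some (Gen x)) ` X"
  show "steiner_loop (S_loop X)" by (rule steiner_loop_S_loop)
  show B: "?B \<subseteq> carrier (S_loop X)"
    by (auto simp: S_carrier_def intro: irreducible.gen)
  fix L :: "'b monoid" and f
  assume "steiner_loop L" and f: "f \<in> ?B \<rightarrow> carrier L"
  then interpret steiner_loop L by simp
  \<comment> \<open>\<open>f\<close> is given on one-letter words, whereas evaluation needs a map on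
    the letters.\<close>
  define g where "g x = f (Some (Gen x))" for x
  have g: "g \<in> X \<rightarrow> carrier L" using f by (auto simp: g_def)
  show "\<exists>!h. h \<in> hom (S_loop X) L \<inter> extensional (carrier (S_loop X)) \<and> (\<forall>b\<in>?B. h b = f b)"
  proof (rule ex1I)
    show "restrict (S_eval L g) (S_carrier X) \<in> hom (S_loop X) L \<inter> extensional (carrier (S_loop X)) \<and>
        (\<forall>b\<in>?B. restrict (S_eval L g) (S_carrier X) b = f b)"
      using S_eval_hom[OF g] B by (auto simp: g_def)
  next
    fix h assume "h \<in> hom (S_loop X) L \<inter> extensional (carrier (S_loop X)) \<and> (\<forall>b\<in>?B. h b = f b)"
    then have h: "h \<in> hom (S_loop X) L" "h \<in> extensional (S_carrier X)"
      and hf: "\<And>x. x \<in> X \<Longrightarrow> h (Some (Gen x)) = g x"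
      by (auto simp: g_def)
    show "h = restrict (S_eval L g) (S_carrier X)"
      \<comment> \<open>Both maps are \<open>undefined\<close> off the carrier, so agreement on
        irreducible words and the empty word is enough.\<close>
      using h(2) hom_S_loop_eq_S_eval[OF h(1) hf]
      by (intro extensionalityI[of _ "S_carrier X"]) auto
  qed
qed

theorem proposition1:
  fixes X :: "'a::linorder set"
  assumes "finite X"
  shows "(\<forall>u\<in>S_carrier X. \<forall>v\<in>S_carrier X. \<exists>!z. S_prod X u v z) \<and>
         free_steiner_loop TYPE('b) (S_loop X) ((\<lambda>x. Some (Gen x)) ` X)"
  using S_prod_ex1 free_steiner_loop_S_loop by blast

end
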